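(* For $\tau>0$, let $S^*(\tau)$ be the set of $(x_1,x_2)\in[0,1]^2$ for which the inequalities $\|2^nx_1\|<e^{-n\tau}$ and $\|3^nx_2\|<e^{-n^2}$ hold simultaneously for infinitely many $n\in\mathbb{N}$. Then $$\dim_{\rm H}S^*(\tau)=\min\Big\{1,\ \frac{\log2+\log3}{\log2+\tau}\Big\}.$$
   Context: $\|\cdot\|$ denotes distance to the nearest integer; $\dim_{\rm H}$ is Hausdorff dimension. *)

theory Defs
  imports "HOL-Analysis.Analysis"
begin

definition dist_nearest_int :: "real \<Rightarrow> real" where
  "dist_nearest_int x = infdist x \<int>"

text \<open>
  The gauge \<open>diam(U)\<^sup>s\<close>. Since \<open>0 powr s = 0\<close> for every \<open>s\<close>, including \<open>s = 0\<close>, the case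
  \<open>s = 0\<close> is separate, so that the 0-dimensional Hausdorff measure is counting measure.
\<close>

definition diam_powr :: "real \<Rightarrow> 'a::metric_space set \<Rightarrow> ennreal" where
  "diam_powr s U =
    (if U = {} then 0 else if s = 0 then 1 else ennreal (diameter U powr s))"

text \<open>
  Covers are sequences of sets; finite covers are included by padding with \<open>{}\<close>. Boundedness is
  required because \<open>diameter\<close> is unspecified on unbounded sets.
\<close>

definition hausdorff_premeasure :: "real \<Rightarrow> real \<Rightarrow> 'a::metric_space set \<Rightarrow> ennreal" where
  "hausdorff_premeasure s \<delta> A =
    (INF U \<in> {U :: nat \<Rightarrow> 'a set.
                A \<subseteq> (\<Union>i. U i) \<and> (\<forall>i. bounded (U i) \<and> diameter (U i) \<le> \<delta>)}.
      \<Sum>i. diam_powr s (U i))"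

definition hausdorff_measure :: "real \<Rightarrow> 'a::metric_space set \<Rightarrow> ennreal" where
  "hausdorff_measure s A = (SUP \<delta> \<in> {0<..}. hausdorff_premeasure s \<delta> A)"

definition hausdorff_dim :: "'a::metric_space set \<Rightarrow> ennreal" where
  "hausdorff_dim A = (INF s \<in> {s. 0 \<le> s \<and> hausdorff_measure s A = 0}. ennreal s)"

text \<open>The product type \<open>real \<times> real\<close> carries the Euclidean metric.\<close>

definition S_star :: "real \<Rightarrow> (real \<times> real) set" where
  "S_star \<tau> =
    {(x1, x2). x1 \<in> {0..1} \<and> x2 \<in> {0..1} \<and>
       infinite {n::nat. dist_nearest_int (2 ^ n * x1) < exp (- (real n * \<tau>)) \<and>
                         dist_nearest_int (3 ^ n * x2) < exp (- ((real n)\<^sup>2))}}"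

end

theory Submission
  imports Defs "HOL-Probability.Probability"
begin

text \<open>
  Upper bound: level \<open>n\<close> of the limsup set is covered by \<open>O(6\<^sup>n)\<close> squares of side
  \<open>exp (- n (ln 2 + \<tau>))\<close>, and also, ignoring the condition on \<open>x1\<close>, by \<open>O(3\<^sup>n exp (n\<^sup>2))\<close>
  squares of side \<open>exp (- n\<^sup>2)\<close>.

  Lower bound: choose the binary digits of \<open>x1\<close> and the ternary digits of \<open>x2\<close> independently and
  uniformly, except that runs of zeros of lengths about \<open>n \<tau> / ln 2\<close> and \<open>n\<^sup>2 / ln 3\<close> are forced
  from position \<open>n\<close> on, for \<open>n\<close> in a rapidly increasing sequence. The resulting point always lies in
  the limsup set. A set of diameter \<open>r = exp (- L)\<close> meets at most two binary intervals of length
  about \<open>r\<close> and two ternary ones, so its probability is at most a constant times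
  \<open>exp (G - 2 L)\<close>, where \<open>G\<close> is the entropy lost to the forced zeros up to scale \<open>r\<close>.
  Earlier runs are negligible and the current run contributes at most \<open>(2 - t) L\<close>
  for the claimed dimension \<open>t\<close>, so countable subadditivity (the mass distribution principle)
  forbids covers of small \<open>s\<close>-dimensional cost for \<open>s < t\<close>.
\<close>

subsection \<open>Hausdorff measure and dimension\<close>

text \<open>The Borel-Cantelli argument for Hausdorff measure: every point of \<open>A\<close> lies
  in some \<open>V n j\<close> with \<open>n\<close> beyond any threshold \<open>N\<close>, so the
  sets of all levels from \<open>N\<close> on form a cover, and its cost is at most a tail of a
  convergent series.\<close>

lemma hausdorff_measure_limsup_eq_0:
  fixes A :: "'a::metric_space set" and V :: "nat \<Rightarrow> 'b \<Rightarrow> 'a set" and d :: "nat \<Rightarrow> real"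
  assumes s: "s > 0"
    and fin: "\<And>n. finite (J n)"
    and bdd: "\<And>n j. j \<in> J n \<Longrightarrow> bounded (V n j)"
    and diam: "\<And>n j. j \<in> J n \<Longrightarrow> diameter (V n j) \<le> d n"
    and d: "d \<longlonglongrightarrow> 0"
    and summ: "summable (\<lambda>n. real (card (J n)) * d n powr s)"
    and inf: "\<And>x. x \<in> A \<Longrightarrow> infinite {n. \<exists>j\<in>J n. x \<in> V n j}"
  shows "hausdorff_measure s A = 0"
proof -
  define g where "g n = real (card (J n)) * d n powr s" for n
  have "hausdorff_premeasure s \<delta> A \<le> ennreal \<epsilon>" if \<delta>: "\<delta> > 0" and \<epsilon>: "\<epsilon> > 0" for \<delta> \<epsilon> :: real
  proof -
    have "eventually (\<lambda>n. d n < \<delta>) sequentially"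
      using d \<delta> by (simp add: order_tendstoD(2))
    then obtain N1 where N1: "\<And>n. n \<ge> N1 \<Longrightarrow> d n < \<delta>"
      by (auto simp: eventually_sequentially)
    obtain N2 where N2: "\<And>n. n \<ge> N2 \<Longrightarrow> norm (\<Sum>i. g (i + n)) < \<epsilon>"
      using suminf_exist_split[OF \<epsilon>, of g] summ unfolding g_def by blast
    define N where "N = max N1 N2"
    have "\<exists>e. bij_betw e {0..<card (J n)} (J n)" for n
      using fin ex_bij_betw_nat_finite by blast
    then obtain e where e: "\<And>n. bij_betw (e n) {0..<card (J n)} (J n)"
      by metis
    have eJ: "e n j \<in> J n" if "j < card (J n)" for n j
      using e[of n] that by (auto simp: bij_betw_def)
    \<comment> \<open>Row \<open>n\<close> enumerates level \<open>n + N\<close> and is padded with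
      empty sets, which have gauge 0. Composing with \<open>prod_decode\<close> turns this double
      family into the sequence that the premeasure requires.\<close>
    define W where "W = (\<lambda>(n, j). if j < card (J (n + N)) then V (n + N) (e (n + N) j) else {})"
    have sub: "A \<subseteq> (\<Union>i. W (prod_decode i))"
    proof
      fix x assume "x \<in> A"
      then obtain n where n: "n \<ge> N" "\<exists>j\<in>J n. x \<in> V n j"
        using inf[of x] unfolding infinite_nat_iff_unbounded_le by blast
      then obtain j where j: "j \<in> J n" "x \<in> V n j" by blast
      then obtain k where k: "k < card (J n)" "e n k = j"
        using e[of n] by (force simp: bij_betw_def image_iff)
      have "x \<in> W (prod_decode (prod_encode (n - N, k)))"
        using n k j by (simp add: W_def)
      then show "x \<in> (\<Union>i. W (prod_decode i))" by blast
    qed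
    have bW: "bounded (W p) \<and> diameter (W p) \<le> \<delta>" for p
    proof (cases p)
      case (Pair n j)
      show ?thesis
      proof (cases "j < card (J (n + N))")
        case True
        have "d (n + N) < \<delta>" by (rule N1) (simp add: N_def)
        with True show ?thesis
          using bdd[OF eJ[OF True]] diam[OF eJ[OF True]] by (simp add: W_def Pair)
      qed (use \<delta> in \<open>simp add: W_def Pair\<close>)
    qed
    have gnn: "g n \<ge> 0" for n by (simp add: g_def)
    have row: "(\<Sum>j. diam_powr s (W (n, j))) \<le> ennreal (g (n + N))" for n
    proof -
      have "(\<Sum>j. diam_powr s (W (n, j))) = (\<Sum>j<card (J (n + N)). diam_powr s (W (n, j)))"
        by (rule suminf_finite) (auto simp: W_def diam_powr_def)
      also have "\<dots> \<le> (\<Sum>j<card (J (n + N)). ennreal (d (n + N) powr s))"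
      proof (rule sum_mono)
        fix j assume "j \<in> {..<card (J (n + N))}"
        then have j: "j < card (J (n + N))" by simp
        have "diameter (W (n, j)) powr s \<le> d (n + N) powr s"
          using bdd[OF eJ[OF j]] diam[OF eJ[OF j]] j s
          by (intro powr_mono2) (auto simp: W_def diameter_ge_0)
        then show "diam_powr s (W (n, j)) \<le> ennreal (d (n + N) powr s)"
          using s by (simp add: diam_powr_def ennreal_leI)
      qed
      also have "\<dots> = ennreal (g (n + N))"
        by (simp add: g_def ennreal_mult ennreal_of_nat_eq_real_of_nat)
      finally show ?thesis .
    qed
    have "hausdorff_premeasure s \<delta> A \<le> (\<Sum>i. diam_powr s (W (prod_decode i)))"
      unfolding hausdorff_premeasure_def by (rule INF_lower) (use sub bW in auto)
    also have "\<dots> = (\<Sum>n. \<Sum>j. diam_powr s (W (n, j)))"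
      by (rule suminf_ennreal_2dimen[of _ "\<lambda>p. diam_powr s (W p)"]) simp
    also have "\<dots> \<le> (\<Sum>n. ennreal (g (n + N)))"
      by (intro suminf_le row summableI)
    also have "\<dots> = ennreal (\<Sum>n. g (n + N))"
      using gnn summable_ignore_initial_segment[OF summ[folded g_def]] by (intro suminf_ennreal2) auto
    also have "\<dots> \<le> ennreal \<epsilon>"
      using N2[of N] by (intro ennreal_leI) (simp add: N_def)
    finally show ?thesis .
  qed
  then have "hausdorff_premeasure s \<delta> A \<le> 0" if "\<delta> > 0" for \<delta>
    using that ennreal_le_epsilon[of 0 "hausdorff_premeasure s \<delta> A"] by simp
  then show ?thesis
    unfolding hausdorff_measure_def by (intro antisym SUP_least zero_le) simp
qed

lemma hausdorff_dim_le:
  assumes "t \<ge> 0" and "\<And>s. s > t \<Longrightarrow> hausdorff_measure s A = 0"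
  shows "hausdorff_dim A \<le> ennreal t"
proof (rule ennreal_le_epsilon)
  fix \<epsilon> :: real assume "\<epsilon> > 0"
  then have "hausdorff_dim A \<le> ennreal (t + \<epsilon>)"
    unfolding hausdorff_dim_def using assms by (intro INF_lower) auto
  then show "hausdorff_dim A \<le> ennreal t + ennreal \<epsilon>"
    using assms \<open>\<epsilon> > 0\<close> by (simp add: ennreal_plus)
qed

lemma hausdorff_dim_ge:
  assumes "\<And>s. 0 \<le> s \<Longrightarrow> s < t \<Longrightarrow> hausdorff_measure s A \<noteq> 0"
  shows "ennreal t \<le> hausdorff_dim A"
  unfolding hausdorff_dim_def using assms by (intro INF_greatest) (force intro: ennreal_leI)

lemma hausdorff_measure_zero_cover:
  fixes A :: "'a::metric_space set"
  assumes "hausdorff_measure s A = 0" and "\<delta> > 0" and "\<eta> > 0"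
  obtains U :: "nat \<Rightarrow> 'a set" where "A \<subseteq> (\<Union>i. U i)" "\<And>i. bounded (U i)"
    "\<And>i. diameter (U i) \<le> \<delta>" "(\<Sum>i. diam_powr s (U i)) < \<eta>"
proof -
  have "hausdorff_premeasure s \<delta> A \<le> 0"
    using assms(1,2) SUP_upper[of \<delta> "{0<..}" "\<lambda>\<delta>. hausdorff_premeasure s \<delta> A"]
    unfolding hausdorff_measure_def by simp
  then have "hausdorff_premeasure s \<delta> A < \<eta>" using assms(3) by simp
  then show ?thesis using that unfolding hausdorff_premeasure_def INF_less_iff by blast
qed

section \<open>Distance to the nearest integer\<close>

lemma dist_nearest_int_le:
  assumes "z \<in> \<int>"
  shows "dist_nearest_int x \<le> \<bar>x - z\<bar>"
  using infdist_le[OF assms, of x] by (simp add: dist_nearest_int_def dist_real_def)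

lemma dist_nearest_int_lessE:
  assumes "dist_nearest_int x < r"
  obtains z :: int where "\<bar>x - of_int z\<bar> < r"
proof -
  have "\<exists>z\<in>\<int>. dist x z < r"
    using assms cINF_less_iff[of "\<int>" "dist x" r]
    by (auto simp: dist_nearest_int_def infdist_def Ints_def intro: bdd_belowI2[where m=0])
  then show ?thesis using that by (auto simp: Ints_def dist_real_def)
qed

text \<open>Since \<open>r \<le> 1\<close>, the close integer lies strictly between -1 and
  \<open>b ^ n + 1\<close>; hence only the \<open>b ^ n + 1\<close> grid points of
  \<open>[0,1]\<close> occur as centres.\<close>

lemma dist_nearest_int_power_lessE:
  assumes "dist_nearest_int (real b ^ n * x) < r" and "0 < b" and "x \<in> {0..1}" and "r \<le> 1"
  obtains p where "p \<le> b ^ n" and "\<bar>x - real p / real b ^ n\<bar> \<le> r / real b ^ n"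
proof -
  obtain z :: int where z: "\<bar>real b ^ n * x - of_int z\<bar> < r"
    using dist_nearest_int_lessE[OF assms(1)] .
  have pos: "real b ^ n > 0" using assms(2) by simp
  have "0 \<le> real b ^ n * x" "real b ^ n * x \<le> real b ^ n"
    using assms(3) pos by (auto simp: mult_le_cancel_left1 intro: mult_nonneg_nonneg)
  then have "- 1 < real_of_int z" "real_of_int z < of_int (int (b ^ n)) + 1"
    using z assms(4) by auto
  then have zr: "0 \<le> z" "z \<le> int (b ^ n)" by linarith+
  have "\<bar>x - of_int z / real b ^ n\<bar> = \<bar>real b ^ n * x - of_int z\<bar> / real b ^ n"
    using pos by (simp add: abs_if field_simps)
  also have "\<dots> \<le> r / real b ^ n"
    using z pos by (simp add: divide_right_mono)
  finally show ?thesis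
    using that[of "nat z"] zr by (simp add: nat_le_iff)
qed

subsection \<open>Covers of the limsup set\<close>

lemma bounded_rectangle: "bounded ({a..b} \<times> {c..d} :: (real \<times> real) set)"
  by (simp add: bounded_Times)

lemma diameter_rectangle_le:
  fixes a b u v :: real
  assumes "0 \<le> u" "0 \<le> v"
  shows "diameter ({a - u..a + u} \<times> {b - v..b + v}) \<le> 2 * (u + v)"
proof (rule diameter_le)
  fix x y assume xy: "x \<in> {a - u..a + u} \<times> {b - v..b + v}" "y \<in> {a - u..a + u} \<times> {b - v..b + v}"
  have "norm (x - y) \<le> norm (fst (x - y)) + norm (snd (x - y))"
    using norm_Pair_le[of "fst (x - y)" "snd (x - y)"] by (simp only: prod.collapse)
  also have "\<dots> \<le> 2 * u + 2 * v"
    using xy by (intro add_mono) (auto simp: mem_Times_iff abs_if)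
  finally show "norm (x - y) \<le> 2 * (u + v)" by simp
qed (use assms in simp)

text \<open>Completing the square. The constant is four times the sharp one; what counts is that it
  does not depend on \<open>x\<close>, so that a factor \<open>exp (- n\<^sup>2)\<close> absorbs any
  geometric growth in \<open>n\<close>.\<close>

lemma linear_minus_quadratic_le:
  fixes x A B :: real
  assumes "B > 0"
  shows "x * A - x\<^sup>2 * B \<le> A\<^sup>2 / B"
proof -
  have "0 \<le> (A - x * B / 2)\<^sup>2 + (x * B)\<^sup>2 * 3 / 4" by simp
  also have "\<dots> = A\<^sup>2 - (x * A - x\<^sup>2 * B) * B" by (simp add: power2_eq_square field_simps)
  finally show ?thesis using assms by (simp add: pos_le_divide_eq)
qed

lemma S_star_grid_points:
  assumes "\<tau> > 0" and "x \<in> S_star \<tau>"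
  shows "infinite {n. \<exists>p\<le>2 ^ n. \<exists>q\<le>3 ^ n.
           \<bar>fst x - real p / 2 ^ n\<bar> \<le> exp (- (real n * \<tau>)) / 2 ^ n \<and>
           \<bar>snd x - real q / 3 ^ n\<bar> \<le> exp (- ((real n)\<^sup>2)) / 3 ^ n}"
    (is "infinite ?T")
proof -
  obtain x1 x2 where x: "x = (x1, x2)" by (cases x)
  let ?S = "{n. dist_nearest_int (2 ^ n * x1) < exp (- (real n * \<tau>)) \<and>
                dist_nearest_int (3 ^ n * x2) < exp (- ((real n)\<^sup>2))}"
  have x01: "x1 \<in> {0..1}" "x2 \<in> {0..1}" and inf: "infinite ?S"
    using assms(2) by (auto simp: S_star_def x)
  have "?S \<subseteq> ?T"
  proof
    fix n assume n: "n \<in> ?S"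
    obtain p where p: "p \<le> 2 ^ n" "\<bar>x1 - real p / 2 ^ n\<bar> \<le> exp (- (real n * \<tau>)) / 2 ^ n"
      using dist_nearest_int_power_lessE[of 2 n x1 "exp (- (real n * \<tau>))"] n x01 assms(1) by auto
    obtain q where q: "q \<le> 3 ^ n" "\<bar>x2 - real q / 3 ^ n\<bar> \<le> exp (- ((real n)\<^sup>2)) / 3 ^ n"
      using dist_nearest_int_power_lessE[of 3 n x2 "exp (- ((real n)\<^sup>2))"] n x01 by auto
    show "n \<in> ?T" using p q x by auto
  qed
  then show ?thesis using inf by (rule infinite_super)
qed

text \<open>Level \<open>n\<close> consists of rectangles around about \<open>6 ^ n\<close> grid
  points. The second side is the shorter one up to a constant factor, so each rectangle costs about
  \<open>(r ^ n) powr s\<close>, and the total cost is a geometric series.\<close>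

lemma hausdorff_measure_S_star_eq_0_of_gt_ratio:
  assumes \<tau>: "\<tau> > 0" and s: "s > (ln 2 + ln 3) / (ln 2 + \<tau>)"
  shows "hausdorff_measure s (S_star \<tau>) = 0"
proof -
  \<comment> \<open>With this choice \<open>r ^ n\<close> is exactly the half-width in the first
    coordinate. The factor \<open>exp (\<tau>\<^sup>2)\<close> in \<open>V\<close> makes the second
    half-width dominate \<open>exp (- n\<^sup>2) / 3 ^ n\<close> for every \<open>n\<close>,
    including small ones.\<close>
  define r where "r = exp (- \<tau>) / 2"
  define C where "C = 2 * (1 + exp (\<tau>\<^sup>2))"
  define V where "V = (\<lambda>n (p, q). {real p / 2 ^ n - r ^ n..real p / 2 ^ n + r ^ n} \<times>
    {real q / 3 ^ n - exp (\<tau>\<^sup>2) * r ^ n..real q / 3 ^ n + exp (\<tau>\<^sup>2) * r ^ n} :: (real \<times> real) set)"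
  have "exp (- \<tau>) < 1" using \<tau> by simp
  then have r: "0 < r" "r < 1" unfolding r_def by (simp, linarith)
  have C: "C > 0" by (simp add: C_def add_pos_pos)
  have w: "ln 2 + \<tau> > 0" using \<tau> by (intro add_pos_pos) auto
  have "0 < (ln 2 + ln 3) / (ln 2 + \<tau>)" by (intro divide_pos_pos[OF _ w] add_pos_pos) auto
  then have s0: "s > 0" using s by linarith
  have wid1: "exp (- (real n * \<tau>)) / 2 ^ n = r ^ n" for n
    by (simp add: r_def power_divide exp_of_nat_mult[symmetric])
  have wid2: "exp (- ((real n)\<^sup>2)) / 3 ^ n \<le> exp (\<tau>\<^sup>2) * r ^ n" for n
  proof -
    have "real n * \<tau> - (real n)\<^sup>2 \<le> \<tau>\<^sup>2"
      using linear_minus_quadratic_le[of 1 "real n" \<tau>] by simp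
    then have "exp (- ((real n)\<^sup>2)) \<le> exp (\<tau>\<^sup>2) * exp (- (real n * \<tau>))"
      by (simp add: exp_add[symmetric])
    then have "exp (- ((real n)\<^sup>2)) / 3 ^ n \<le> (exp (\<tau>\<^sup>2) * exp (- (real n * \<tau>))) / 2 ^ n"
      by (intro frac_le power_mono) auto
    then show ?thesis by (simp add: wid1[symmetric])
  qed
  \<comment> \<open>After taking logarithms, this is the assumed lower bound on
    \<open>s\<close>.\<close>
  have lt1: "6 * r powr s < 1"
  proof -
    have "ln 2 + ln 3 < s * (ln 2 + \<tau>)" using s w by (simp add: pos_divide_less_eq)
    moreover have "s * ln r = - (s * (ln 2 + \<tau>))" by (simp add: r_def ln_div algebra_simps)
    moreover have "ln 6 = ln 2 + ln (3::real)" using ln_mult[of 2 "3::real"] by simp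
    ultimately have "ln 6 + s * ln r < 0" by linarith
    then have "exp (ln 6 + s * ln r) < 1" by simp
    then show ?thesis using r by (simp add: exp_add powr_def)
  qed
  show ?thesis
  proof (rule hausdorff_measure_limsup_eq_0[OF s0, where J = "\<lambda>n. {..2 ^ n} \<times> {..3 ^ n}" and V = V
        and d = "\<lambda>n. C * r ^ n"])
    fix n j assume "j \<in> {..2 ^ n :: nat} \<times> {..3 ^ n :: nat}"
    show "bounded (V n j)" by (auto simp: V_def bounded_rectangle split: prod.split)
    have "2 * (r ^ n + exp (\<tau>\<^sup>2) * r ^ n) = C * r ^ n" by (simp add: C_def algebra_simps)
    then show "diameter (V n j) \<le> C * r ^ n"
      using diameter_rectangle_le[of "r ^ n" "exp (\<tau>\<^sup>2) * r ^ n"] r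
      by (auto simp: V_def split: prod.split)
  next
    show "(\<lambda>n. C * r ^ n) \<longlonglongrightarrow> 0"
      using r by (auto intro!: tendsto_mult_right_zero LIMSEQ_power_zero)
  next
    show "summable (\<lambda>n. real (card ({..2 ^ n :: nat} \<times> {..3 ^ n :: nat})) * (C * r ^ n) powr s)"
    proof (rule summable_comparison_test')
      show "summable (\<lambda>n. 4 * C powr s * (6 * r powr s) ^ n)"
        using lt1 by (intro summable_mult summable_geometric) simp
      fix n :: nat
      have "real (card ({..2 ^ n :: nat} \<times> {..3 ^ n :: nat})) = (2 ^ n + 1) * (3 ^ n + 1)"
        by (simp add: card_cartesian_product algebra_simps)
      also have "\<dots> \<le> (2 * 2 ^ n) * (2 * 3 ^ n)"
        by (intro mult_mono) auto
      also have "\<dots> = 4 * (6::real) ^ n"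
        using power_mult_distrib[of 2 "3::real" n] by simp
      finally have c: "real (card ({..2 ^ n :: nat} \<times> {..3 ^ n :: nat})) \<le> 4 * 6 ^ n" .
      have p: "(C * r ^ n) powr s = C powr s * (r powr s) ^ n"
        using C r by (simp add: powr_mult powr_powr powr_realpow[symmetric] mult.commute)
      show "norm (real (card ({..2 ^ n :: nat} \<times> {..3 ^ n :: nat})) * (C * r ^ n) powr s)
              \<le> 4 * C powr s * (6 * r powr s) ^ n"
        using mult_right_mono[OF c, of "C powr s * (r powr s) ^ n"]
        by (simp add: p power_mult_distrib abs_mult mult_ac)
    qed
  next
    fix x assume "x \<in> S_star \<tau>"
    from S_star_grid_points[OF \<tau> this]
    show "infinite {n. \<exists>j\<in>{..2 ^ n} \<times> {..3 ^ n}. x \<in> V n j}"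
    proof (rule infinite_super[rotated], intro subsetI, clarsimp)
      fix n p q :: nat
      assume pq: "p \<le> 2 ^ n" "q \<le> 3 ^ n" "\<bar>fst x - real p / 2 ^ n\<bar> \<le> exp (- (real n * \<tau>)) / 2 ^ n"
        "\<bar>snd x - real q / 3 ^ n\<bar> \<le> exp (- ((real n)\<^sup>2)) / 3 ^ n"
      then have "x \<in> V n (p, q)"
        using wid2[of n] by (auto simp: V_def wid1 mem_Times_iff abs_le_iff)
      then show "\<exists>p\<in>{..2 ^ n}. \<exists>q\<in>{..3 ^ n}. x \<in> V n (p, q)" using pq by blast
    qed
  qed simp
qed

text \<open>The first coordinate is cut into a grid of mesh \<open>exp (- n\<^sup>2)\<close>,
  whatever its Diophantine condition. The cost of level \<open>n\<close> is then of order
  \<open>3 ^ n * exp ((1 - s) * n\<^sup>2)\<close>, which is summable for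
  \<open>s > 1\<close>.\<close>

lemma hausdorff_measure_S_star_eq_0_of_gt_1:
  assumes \<tau>: "\<tau> > 0" and s: "s > 1"
  shows "hausdorff_measure s (S_star \<tau>) = 0"
proof -
  define e where "e n = exp (- ((real n)\<^sup>2))" for n :: nat
  \<comment> \<open>Index of the last grid cell of mesh \<open>e n\<close> that meets
    \<open>[0,1]\<close>.\<close>
  define K where "K n = nat \<lfloor>1 / e n\<rfloor>" for n
  define V where "V = (\<lambda>n (p, q). {real p * e n - e n..real p * e n + e n} \<times>
    {real q / 3 ^ n - e n..real q / 3 ^ n + e n})"
  have e: "0 < e n" "e n \<le> 1" for n by (auto simp: e_def)
  have K: "real (K n) \<le> 1 / e n" for n using e[of n] by (simp add: K_def)
  show ?thesis
  proof (rule hausdorff_measure_limsup_eq_0[of s "\<lambda>n. {..K n} \<times> {..3 ^ n}" V "\<lambda>n. 4 * e n"])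
    fix n j assume "j \<in> {..K n} \<times> {..3 ^ n :: nat}"
    show "bounded (V n j)" by (auto simp: V_def bounded_rectangle split: prod.split)
    show "diameter (V n j) \<le> 4 * e n"
      using diameter_rectangle_le[of "e n" "e n"] e[of n]
      by (auto simp: V_def split: prod.split)
  next
    have "filterlim (\<lambda>n. real n ^ 2) at_top sequentially"
      by (intro filterlim_pow_at_top filterlim_real_sequentially) simp
    then have "e \<longlonglongrightarrow> 0"
      unfolding e_def
      by (intro filterlim_compose[OF exp_at_bot] filterlim_compose[OF filterlim_uminus_at_bot_at_top])
    then show "(\<lambda>n. 4 * e n) \<longlonglongrightarrow> 0" by (rule tendsto_mult_right_zero)
  next
    define D where "D = 6 * 4 powr s * exp ((ln 3 + 1)\<^sup>2 / (s - 1))"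
    show "summable (\<lambda>n. real (card ({..K n} \<times> {..3 ^ n :: nat})) * (4 * e n) powr s)"
    proof (rule summable_comparison_test')
      show "summable (\<lambda>n. D * exp (- 1) ^ n)"
        by (intro summable_mult summable_geometric) simp
      fix n :: nat
      have "1 \<le> 1 / e n" using e[of n] by simp
      have "real (card ({..K n} \<times> {..3 ^ n :: nat})) = (real (K n) + 1) * (3 ^ n + 1)"
        by (simp add: card_cartesian_product algebra_simps)
      also have "\<dots> \<le> (2 * (1 / e n)) * (2 * 3 ^ n)"
      proof (rule mult_mono)
        show "real (K n) + 1 \<le> 2 * (1 / e n)" using K[of n] \<open>1 \<le> 1 / e n\<close> by linarith
      qed (use e[of n] in auto)
      also have "\<dots> \<le> 6 * exp (real n * ln 3 + (real n)\<^sup>2)"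
        by (simp add: e_def exp_add exp_of_nat_mult exp_minus field_simps)
      finally have c: "real (card ({..K n} \<times> {..3 ^ n :: nat})) \<le> 6 * exp (real n * ln 3 + (real n)\<^sup>2)" .
      have p: "(4 * e n) powr s = 4 powr s * exp (- (real n)\<^sup>2 * s)"
        by (simp add: powr_mult e_def exp_powr_real)
      have "real (card ({..K n} \<times> {..3 ^ n :: nat})) * (4 * e n) powr s
          \<le> 6 * exp (real n * ln 3 + (real n)\<^sup>2) * (4 * e n) powr s"
        by (rule mult_right_mono[OF c]) simp
      also have "\<dots> = 6 * 4 powr s * (exp (real n * ln 3 + (real n)\<^sup>2) * exp (- (real n)\<^sup>2 * s))"
        unfolding p by simp
      also have "\<dots> = 6 * 4 powr s * exp (real n * ln 3 + (real n)\<^sup>2 - (real n)\<^sup>2 * s)"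
        by (simp add: mult_exp_exp)
      \<comment> \<open>The quadratic bound is applied with slope \<open>ln 3 + 1\<close> instead of
        \<open>ln 3\<close>; the additional 1 leaves the factor \<open>exp (- n)\<close> for the
        geometric comparison.\<close>
      also have "\<dots> \<le> 6 * 4 powr s * exp ((ln 3 + 1)\<^sup>2 / (s - 1) - real n)"
        using linear_minus_quadratic_le[of "s - 1" "real n" "ln 3 + 1"] s
        by (intro mult_left_mono) (auto simp: algebra_simps)
      also have "\<dots> = D * exp (- 1) ^ n"
        by (simp add: D_def exp_diff exp_of_nat_mult[symmetric] exp_minus field_simps)
      finally show "norm (real (card ({..K n} \<times> {..3 ^ n :: nat})) * (4 * e n) powr s) \<le> D * exp (- 1) ^ n"
        by simp
    qed
  next
    fix x assume x: "x \<in> S_star \<tau>"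
    then have x1: "0 \<le> fst x" "fst x \<le> 1" by (auto simp: S_star_def)
    from S_star_grid_points[OF \<tau> x]
    show "infinite {n. \<exists>j\<in>{..K n} \<times> {..3 ^ n}. x \<in> V n j}"
    proof (rule infinite_super[rotated], intro subsetI, clarsimp)
      fix n q :: nat
      assume q: "q \<le> 3 ^ n" "\<bar>snd x - real q / 3 ^ n\<bar> \<le> exp (- ((real n)\<^sup>2)) / 3 ^ n"
      have "exp (- ((real n)\<^sup>2)) / 3 ^ n \<le> e n"
        by (simp add: e_def pos_divide_le_eq mult_le_cancel_left1)
      then have y: "\<bar>snd x - real q / 3 ^ n\<bar> \<le> e n" using q(2) by linarith
      define p where "p = nat \<lfloor>fst x / e n\<rfloor>"
      have "p \<le> K n"
        unfolding p_def K_def using x1 e[of n] by (intro nat_mono floor_mono divide_right_mono) auto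
      moreover have "real p \<le> fst x / e n" "fst x / e n < real p + 1"
        using x1 e[of n] by (auto simp: p_def)
      then have "real p * e n \<le> fst x" "fst x < real p * e n + e n"
        using e[of n] by (simp_all add: field_simps)
      then have "x \<in> V n (p, q)"
        using y e[of n] by (auto simp: V_def mem_Times_iff abs_le_iff)
      ultimately show "\<exists>p\<in>{..K n}. \<exists>q\<in>{..3 ^ n}. x \<in> V n (p, q)" using q by blast
    qed
  qed (use s in simp_all)
qed

subsection \<open>Random digit expansions\<close>

definition digit_sum :: "nat \<Rightarrow> (nat \<Rightarrow> nat) \<Rightarrow> real" where
  "digit_sum b d = (\<Sum>i. real (d i) / real b ^ Suc i)"

text \<open>The integer written in base \<open>b\<close> with the digits \<open>d 0\<close>, ...,
  \<open>d (n - 1)\<close>, most significant first; it names the \<open>b\<close>-adic interval of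
  level \<open>n\<close>.\<close>

primrec digit_prefix :: "nat \<Rightarrow> (nat \<Rightarrow> nat) \<Rightarrow> nat \<Rightarrow> nat" where
  "digit_prefix b d 0 = 0"
| "digit_prefix b d (Suc n) = b * digit_prefix b d n + d n"

text \<open>Division with remainder by \<open>b\<close> recovers the last digit and the shorter
  prefix.\<close>

lemma digit_prefix_inj:
  assumes "\<And>i. d i < b" "\<And>i. d' i < b" "digit_prefix b d m = digit_prefix b d' m" "i < m"
  shows "d i = d' i"
  using assms(3,4)
proof (induction m)
  case (Suc m)
  have b: "d m < b" "d' m < b" using assms by auto
  have eq: "b * digit_prefix b d m + d m = b * digit_prefix b d' m + d' m" using Suc.prems by simp
  have "(b * digit_prefix b d m + d m) mod b = d m" "(b * digit_prefix b d' m + d' m) mod b = d' m"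
    "(b * digit_prefix b d m + d m) div b = digit_prefix b d m"
    "(b * digit_prefix b d' m + d' m) div b = digit_prefix b d' m"
    using b by (auto simp: div_mult_self4)
  then have "d m = d' m" "digit_prefix b d m = digit_prefix b d' m" using eq by metis+
  then show ?case using Suc by (auto simp: less_Suc_eq)
qed simp

text \<open>If some digit sequence has prefix \<open>c\<close>, it serves as \<open>y\<close>;
  otherwise the claim is vacuous. Choosing \<open>y\<close> before \<open>d\<close> turns a
  condition on the prefix into a cylinder condition.\<close>

lemma digit_prefix_determines:
  obtains y where "\<And>d i. (\<And>i. d i < b) \<Longrightarrow> digit_prefix b d m = c \<Longrightarrow> i < m \<Longrightarrow> d i = y i"
proof (cases "\<exists>y. (\<forall>i. y i < b) \<and> digit_prefix b y m = c")
  case True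
  then obtain y where "\<forall>i. y i < b" "digit_prefix b y m = c" by blast
  then show ?thesis using that[of y] digit_prefix_inj[of _ b y m] by blast
next
  case False
  then show ?thesis using that by blast
qed

context
  fixes b :: nat
  assumes b: "b \<ge> 2"
begin

lemma max_digit_sums: "(\<lambda>i. real (b - 1) / real b ^ Suc i) sums 1"
proof -
  have "(\<lambda>i. (real (b - 1) / real b) * (1 / real b) ^ i) sums ((real (b - 1) / real b) * (1 / (1 - 1 / real b)))"
    using b by (intro sums_mult geometric_sums) auto
  moreover have "(real (b - 1) / real b) * (1 / (1 - 1 / real b)) = 1"
    using b by (simp add: divide_simps of_nat_diff)
  ultimately show ?thesis by (simp only: power_divide power_Suc power_one times_divide_times_eq mult_1_right)
qed

lemma digit_term_le: "d i < b \<Longrightarrow> real (d i) / real b ^ Suc i \<le> real (b - 1) / real b ^ Suc i"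
  using b by (intro divide_right_mono) auto

lemma digit_summable:
  assumes "\<And>i. d i < b"
  shows "summable (\<lambda>i. real (d i) / real b ^ Suc i)"
proof (rule summable_comparison_test')
  show "summable (\<lambda>i. real (b - 1) / real b ^ Suc i)"
    using max_digit_sums by (rule sums_summable)
  show "norm (real (d i) / real b ^ Suc i) \<le> real (b - 1) / real b ^ Suc i" for i
    using digit_term_le[of d i] assms by simp
qed

lemma digit_sum_nonneg:
  assumes "\<And>i. d i < b"
  shows "0 \<le> digit_sum b d"
  unfolding digit_sum_def using assms by (intro suminf_nonneg digit_summable) auto

lemma digit_sum_le_1:
  assumes "\<And>i. d i < b"
  shows "digit_sum b d \<le> 1"
proof -
  have "digit_sum b d \<le> (\<Sum>i. real (b - 1) / real b ^ Suc i)"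
    unfolding digit_sum_def
    by (rule suminf_le[OF digit_term_le digit_summable sums_summable[OF max_digit_sums]])
      (use assms in auto)
  then show ?thesis using sums_unique[OF max_digit_sums] by simp
qed

lemma digit_sum_Suc:
  assumes "\<And>i. d i < b"
  shows "real b * digit_sum b d = real (d 0) + digit_sum b (\<lambda>i. d (Suc i))"
proof -
  have "digit_sum b d = (\<Sum>i. real (d (Suc i)) / real b ^ Suc (Suc i)) + real (d 0) / real b"
    unfolding digit_sum_def using suminf_split_initial_segment[OF digit_summable[OF assms], where k = 1] by simp
  also have "(\<Sum>i. real (d (Suc i)) / real b ^ Suc (Suc i))
    = (\<Sum>i. (real (d (Suc i)) / real b ^ Suc i) / real b)" by (simp add: field_simps)
  also have "\<dots> = digit_sum b (\<lambda>i. d (Suc i)) / real b"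
    unfolding digit_sum_def using digit_summable[of "\<lambda>i. d (Suc i)"] assms by (intro suminf_divide) auto
  finally show ?thesis using b by (simp add: field_simps)
qed

text \<open>The value 1 is attained only when all digits are \<open>b - 1\<close>. The induction
  strips leading digits until the zero comes first, where \<open>b \<ge> 2\<close> gives the strict
  inequality.\<close>

lemma digit_sum_less_1:
  assumes "\<And>i. d i < b" and "d j = 0"
  shows "digit_sum b d < 1"
  using assms
proof (induction j arbitrary: d)
  case 0
  have "real b * digit_sum b d \<le> 1"
    using digit_sum_Suc[of d] digit_sum_le_1[of "\<lambda>i. d (Suc i)"] 0 by auto
  moreover have "digit_sum b d < real b * digit_sum b d" if "digit_sum b d > 0"
    using b that by (simp add: mult_less_cancel_right1)
  ultimately show ?case by (cases "digit_sum b d > 0") linarith+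
next
  case (Suc j)
  have "digit_sum b (\<lambda>i. d (Suc i)) < 1" using Suc.IH[of "\<lambda>i. d (Suc i)"] Suc.prems by auto
  moreover have "real (d 0) + 1 \<le> real b" using Suc.prems(1)[of 0] by linarith
  ultimately have "real b * digit_sum b d < real b * 1"
    using digit_sum_Suc[of d] Suc.prems(1) by simp
  then show ?case using b by (simp add: mult_less_cancel_left)
qed

lemma power_mult_digit_sum:
  assumes "\<And>i. d i < b"
  shows "real b ^ n * digit_sum b d = real (digit_prefix b d n) + digit_sum b (\<lambda>i. d (n + i))"
proof (induction n)
  case (Suc n)
  have "real b ^ Suc n * digit_sum b d = real b * real (digit_prefix b d n) + real b * digit_sum b (\<lambda>i. d (n + i))"
    using Suc by (simp add: algebra_simps)
  also have "real b * digit_sum b (\<lambda>i. d (n + i)) = real (d n) + digit_sum b (\<lambda>i. d (Suc n + i))"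
    using digit_sum_Suc[of "\<lambda>i. d (n + i)"] assms by simp
  finally show ?case by simp
qed simp

text \<open>A zero digit at or after position \<open>m\<close> keeps the shifted tail below 1. This
  excludes the ambiguity of \<open>b\<close>-adic expansions, so the floor reads off the prefix
  exactly.\<close>

lemma floor_power_mult_digit_sum:
  assumes "\<And>i. d i < b" and "j \<ge> m" "d j = 0"
  shows "\<lfloor>real b ^ m * digit_sum b d\<rfloor> = int (digit_prefix b d m)"
proof -
  have "digit_sum b (\<lambda>i. d (m + i)) < 1"
    using digit_sum_less_1[of "\<lambda>i. d (m + i)" "j - m"] assms by simp
  moreover have "0 \<le> digit_sum b (\<lambda>i. d (m + i))" using assms by (intro digit_sum_nonneg) auto
  ultimately show ?thesis unfolding power_mult_digit_sum[OF assms(1)] by (simp add: floor_unique)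
qed

lemma digit_prefix_eq_0: "(\<And>i. i < a \<Longrightarrow> d i = 0) \<Longrightarrow> digit_prefix b d a = 0"
  by (induction a) auto

text \<open>Multiplication by \<open>b ^ n\<close> leaves an integer plus a tail that starts with
  \<open>a\<close> zeros, and a further shift by \<open>a\<close> places keeps that tail at most
  1.\<close>

lemma dist_nearest_int_digit_sum_le:
  assumes "\<And>i. d i < b" and "\<And>i. n \<le> i \<Longrightarrow> i < n + a \<Longrightarrow> d i = 0"
  shows "dist_nearest_int (real b ^ n * digit_sum b d) \<le> 1 / real b ^ a"
proof -
  let ?t = "digit_sum b (\<lambda>i. d (n + i))"
  have "real b ^ a * ?t = digit_sum b (\<lambda>i. d (n + (a + i)))"
    using power_mult_digit_sum[of "\<lambda>i. d (n + i)" a] digit_prefix_eq_0[of a "\<lambda>i. d (n + i)"] assms by simp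
  also have "\<dots> \<le> 1" using assms by (intro digit_sum_le_1) auto
  finally have "?t \<le> 1 / real b ^ a" using b by (simp add: field_simps)
  moreover have "0 \<le> ?t" using assms by (intro digit_sum_nonneg) auto
  ultimately show ?thesis
    using dist_nearest_int_le[of "real (digit_prefix b d n)" "real b ^ n * digit_sum b d"]
    by (simp add: power_mult_digit_sum[OF assms(1)])
qed

end

section \<open>Random digits with forced zeros\<close>

definition erase :: "nat set \<Rightarrow> (nat \<Rightarrow> nat) \<Rightarrow> nat \<Rightarrow> nat" where
  "erase Z d i = (if i \<in> Z then 0 else d i)"

text \<open>All digits are drawn freely and the zeros are imposed afterwards by
  \<open>erase\<close>. The measure thus remains a plain product, and erased positions simply drop
  out of the cylinder conditions.\<close>

definition digit_measure :: "nat \<Rightarrow> (nat \<Rightarrow> nat) measure" where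
  "digit_measure b = (\<Pi>\<^sub>M i\<in>UNIV. uniform_count_measure {..<b})"

lemma space_digit_measure: "space (digit_measure b) = {d. \<forall>i. d i < b}"
  by (auto simp: digit_measure_def space_PiM space_uniform_count_measure PiE_UNIV_domain)

lemma prob_space_digit_measure: "b > 0 \<Longrightarrow> prob_space (digit_measure b)"
  unfolding digit_measure_def by (intro prob_space_PiM prob_space_uniform_count_measure) auto

lemma erase_less: "b > 0 \<Longrightarrow> d \<in> space (digit_measure b) \<Longrightarrow> erase Z d i < b"
  by (auto simp: erase_def space_digit_measure)

text \<open>An inequality, because \<open>y i\<close> may fail to be a digit below \<open>b\<close>,
  in which case the cylinder is empty.\<close>

lemma digit_cylinder:
  assumes "b > 0" "finite J"
  shows "{d \<in> space (digit_measure b). \<forall>i\<in>J. d i = y i} \<in> sets (digit_measure b)" (is "?C \<in> _")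
    and "emeasure (digit_measure b) {d \<in> space (digit_measure b). \<forall>i\<in>J. d i = y i}
           \<le> ennreal ((1 / real b) ^ card J)"
proof -
  interpret product_prob_space "\<lambda>i::nat. uniform_count_measure {..<b}" UNIV
    by (rule product_prob_spaceI, rule prob_space_uniform_count_measure) (use assms in auto)
  have C: "?C = {d \<in> space (digit_measure b). \<forall>i\<in>J. d i \<in> {y i} \<inter> {..<b}}"
    by (auto simp: space_digit_measure)
  show "?C \<in> sets (digit_measure b)"
    unfolding C unfolding digit_measure_def
    by (intro sets.sets_Collect_finite_All assms measurable_sets_Collect[OF measurable_component_singleton])
      (auto simp: sets_uniform_count_measure)
  have "emeasure (digit_measure b) ?C
      = (\<Prod>i\<in>J. emeasure (uniform_count_measure {..<b}) ({y i} \<inter> {..<b}))"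
    unfolding C unfolding digit_measure_def using assms
    by (intro emeasure_PiM_Collect) (auto simp: sets_uniform_count_measure)
  also have "\<dots> \<le> (\<Prod>i\<in>J. ennreal (1 / real b))"
  proof (intro prod_mono_ennreal)
    fix i
    have "card ({y i} \<inter> {..<b}) \<le> 1" using card_mono[of "{y i}" "{y i} \<inter> {..<b}"] by simp
    then show "emeasure (uniform_count_measure {..<b}) ({y i} \<inter> {..<b}) \<le> ennreal (1 / real b)"
      using assms by (simp add: emeasure_uniform_count_measure divide_right_mono ennreal_leI)
  qed
  also have "\<dots> = ennreal ((1 / real b) ^ card J)" by (simp add: ennreal_power)
  finally show "emeasure (digit_measure b) ?C \<le> ennreal ((1 / real b) ^ card J)" .
qed

lemma pairwise_close_ints:
  fixes F :: "int set"
  assumes "\<And>x y. x \<in> F \<Longrightarrow> y \<in> F \<Longrightarrow> x \<le> y + 1"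
  obtains a where "F \<subseteq> {a, a + 1}"
proof (cases "F = {}")
  case False
  then obtain f where f: "f \<in> F" by blast
  show ?thesis
  proof (cases "f - 1 \<in> F")
    case True
    have "F \<subseteq> {f - 1, f}" using assms[OF f] assms[OF _ True] by force
    then show ?thesis using that[of "f - 1"] by simp
  next
    case False
    have "x \<in> {f, f + 1}" if "x \<in> F" for x
    proof -
      have "x \<noteq> f - 1" using that False by blast
      then show ?thesis using assms[OF f that] assms[OF that f] by auto
    qed
    then show ?thesis using that[of f] by blast
  qed
qed (use that in blast)

text \<open>On \<open>V\<close> the floor of \<open>b ^ m * x\<close> takes at most two consecutive
  values, so the first \<open>m\<close> digits have at most two possible prefixes. Each prefix
  prescribes the free digits, those outside \<open>Z\<close>, and yields one cylinder. Only a
  measurable superset \<open>C\<close> is claimed because \<open>V\<close> is arbitrary.\<close>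

lemma digit_measure_small_set:
  assumes b: "b \<ge> 2" and Z: "infinite Z"
    and V: "\<And>x y. x \<in> V \<Longrightarrow> y \<in> V \<Longrightarrow> \<bar>x - y\<bar> \<le> 1 / real b ^ m"
  obtains C where "C \<in> sets (digit_measure b)"
    "emeasure (digit_measure b) C \<le> ennreal (2 * (1 / real b) ^ card ({..<m} - Z))"
    "\<And>d. d \<in> space (digit_measure b) \<Longrightarrow> digit_sum b (erase Z d) \<in> V \<Longrightarrow> d \<in> C"
proof -
  let ?M = "digit_measure b"
  let ?w = "(1 / real b) ^ card ({..<m} - Z)"
  have "\<lfloor>real b ^ m * x\<rfloor> \<le> \<lfloor>real b ^ m * y\<rfloor> + 1" if "x \<in> V" "y \<in> V" for x y
  proof -
    have "x - y \<le> 1 / real b ^ m" using V[OF that] by linarith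
    then have "real b ^ m * (x - y) \<le> 1" using b by (simp add: field_simps)
    then have "real b ^ m * x \<le> real b ^ m * y + 1" by (simp add: algebra_simps)
    then have "\<lfloor>real b ^ m * x\<rfloor> \<le> \<lfloor>real b ^ m * y + 1\<rfloor>" by (rule floor_mono)
    then show ?thesis by simp
  qed
  then obtain a where a: "(\<lambda>x. \<lfloor>real b ^ m * x\<rfloor>) ` V \<subseteq> {a, a + 1}"
    using pairwise_close_ints[of "(\<lambda>x. \<lfloor>real b ^ m * x\<rfloor>) ` V"] by blast
  obtain y0 where y0: "\<And>d i. (\<And>i. d i < b) \<Longrightarrow> digit_prefix b d m = nat a \<Longrightarrow> i < m \<Longrightarrow> d i = y0 i"
    using digit_prefix_determines[of b m "nat a"] by blast
  obtain y1 where y1: "\<And>d i. (\<And>i. d i < b) \<Longrightarrow> digit_prefix b d m = nat (a + 1) \<Longrightarrow> i < m \<Longrightarrow> d i = y1 i"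
    using digit_prefix_determines[of b m "nat (a + 1)"] by blast
  define C where "C y = {d \<in> space ?M. \<forall>i\<in>{..<m} - Z. d i = y i}" for y :: "nat \<Rightarrow> nat"
  have C: "C y \<in> sets ?M" "emeasure ?M (C y) \<le> ennreal ?w" for y
    unfolding C_def using digit_cylinder[of b "{..<m} - Z" y] b by auto
  have "emeasure ?M (C y0 \<union> C y1) \<le> emeasure ?M (C y0) + emeasure ?M (C y1)"
    using C by (intro emeasure_subadditive) auto
  also have "\<dots> \<le> ennreal ?w + ennreal ?w" using C by (intro add_mono) auto
  also have "\<dots> = ennreal (2 * ?w)" by (simp add: ennreal_plus[symmetric] del: ennreal_plus)
  finally have le: "emeasure ?M (C y0 \<union> C y1) \<le> ennreal (2 * ?w)" .
  have "d \<in> C y0 \<union> C y1" if d: "d \<in> space ?M" and "digit_sum b (erase Z d) \<in> V" for d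
  proof -
    have lt: "erase Z d i < b" for i using erase_less[OF _ d] b by auto
    \<comment> \<open>An erased position beyond \<open>m\<close> supplies the zero digit that makes
      the floor equal to the prefix.\<close>
    obtain j where "j \<ge> m" "j \<in> Z" using Z unfolding infinite_nat_iff_unbounded_le by blast
    then have fl: "\<lfloor>real b ^ m * digit_sum b (erase Z d)\<rfloor> = int (digit_prefix b (erase Z d) m)"
      using lt b by (intro floor_power_mult_digit_sum[of b _ m j]) (auto simp: erase_def)
    have er: "erase Z d i = d i" if "i \<in> {..<m} - Z" for i using that by (auto simp: erase_def)
    have "int (digit_prefix b (erase Z d) m) \<in> {a, a + 1}" using a that fl by force
    then consider "digit_prefix b (erase Z d) m = nat a" | "digit_prefix b (erase Z d) m = nat (a + 1)"
      by auto
    then show ?thesis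
    proof cases
      case 1
      then show ?thesis using y0[of "erase Z d"] lt er d by (auto simp: C_def)
    next
      case 2
      then show ?thesis using y1[of "erase Z d"] lt er d by (auto simp: C_def)
    qed
  qed
  then show ?thesis using that[of "C y0 \<union> C y1"] C le by blast
qed

subsection \<open>Sparse runs of zeros\<close>

text \<open>
  With \<open>l = ln 2\<close> and \<open>k = ln 3\<close>, the left-hand side bounds the entropy lost to a run starting at
  position \<open>n\<close>; the ternary run counts as unbounded, since \<open>n\<^sup>2\<close> eventually exceeds any multiple of \<open>n\<close>.
\<close>

lemma zero_run_tradeoff:
  fixes l k t \<tau> n m m' L :: real
  assumes "0 < l" "0 < k" "0 < \<tau>" "0 \<le> t" "t \<le> 1" "t * (l + \<tau>) \<le> l + k"
    "0 \<le> n" "n \<le> m" "m * l \<le> L" "m' * k \<le> L"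
  shows "min ((m - n) * l) (n * \<tau>) + max 0 ((m' - n) * k) \<le> (2 - t) * L"
proof -
  have nl: "n * l \<le> m * l" using assms by (intro mult_right_mono) auto
  have nl0: "0 \<le> n * l" using assms by simp
  then have L: "0 \<le> L" using nl assms by linarith
  have tL: "t * L \<le> L" using mult_right_mono[of t 1 L] assms L by simp
  show ?thesis
  proof (cases "m' \<le> n")
    \<comment> \<open>The ternary run has not started at this scale, and the binary loss alone is at
      most \<open>L \<le> (2 - t) * L\<close>.\<close>
    case True
    then have "(m' - n) * k \<le> 0" using assms by (intro mult_nonpos_nonneg) auto
    moreover have "(m - n) * l \<le> L" unfolding left_diff_distrib using assms nl0 by linarith
    ultimately show ?thesis using tL by (simp add: algebra_simps min_le_iff_disj)
  next
    case False
    then have mx: "max 0 ((m' - n) * k) \<le> L - n * k" using assms by (simp add: algebra_simps)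
    show ?thesis
    \<comment> \<open>The threshold is the scale at which the binary run ends. Before it, the losses
      \<open>L - n * l\<close> and \<open>L - n * k\<close> add up to
      \<open>2 * L - n * (l + k)\<close>. After it, the binary loss stays at
      \<open>n * \<tau>\<close>, and since \<open>t \<le> 1\<close> the estimate is tightest at the
      threshold.\<close>
    proof (cases "L \<le> n * (l + \<tau>)")
      case True
      have "t * L \<le> t * (n * (l + \<tau>))" using True assms by (intro mult_left_mono) auto
      also have "\<dots> = n * (t * (l + \<tau>))" by simp
      also have "\<dots> \<le> n * (l + k)" using assms by (intro mult_left_mono) auto
      finally have "t * L \<le> n * l + n * k" by (simp add: algebra_simps)
      moreover have "min ((m - n) * l) (n * \<tau>) \<le> L - n * l"
        using assms by (simp add: algebra_simps min_le_iff_disj)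
      ultimately show ?thesis using mx by (simp add: algebra_simps)
    next
      case False
      have "(1 - t) * (n * (l + \<tau>)) \<le> (1 - t) * L" using False assms by (intro mult_left_mono) auto
      moreover have "n * (t * (l + \<tau>)) \<le> n * (l + k)" using assms by (intro mult_left_mono) auto
      ultimately have "n * \<tau> - n * k \<le> (1 - t) * L" by (simp add: algebra_simps)
      moreover have "min ((m - n) * l) (n * \<tau>) \<le> n * \<tau>" by simp
      ultimately show ?thesis using mx by (simp add: algebra_simps)
    qed
  qed
qed

definition zero_runs :: "(nat \<Rightarrow> nat) \<Rightarrow> (nat \<Rightarrow> nat) \<Rightarrow> nat set" where
  "zero_runs N len = (\<Union>k. {N k..<N k + len (N k)})"

lemma infinite_zero_runs:
  assumes "strict_mono N" "\<And>n. len n > 0"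
  shows "infinite (zero_runs N len)"
proof (rule infinite_super)
  show "range N \<subseteq> zero_runs N len" using assms(2) by (force simp: zero_runs_def)
  show "infinite (range N)"
    using assms(1) by (simp add: range_inj_infinite strict_mono_imp_inj_on)
qed

text \<open>By the gap condition all runs before the \<open>k\<close>-th end at or before
  \<open>N k / R\<close>, so they contain at most that many positions; the current run is counted
  only up to \<open>m\<close>.\<close>

lemma card_zero_runs_le:
  assumes R: "R > 0" and mono: "strict_mono N"
    and gap: "\<And>k. R * (N k + len (N k)) \<le> N (Suc k)"
    and m: "m < N (Suc k)"
  shows "real (card ({..<m} \<inter> zero_runs N len)) \<le> real (N k) / real R + real (min (m - N k) (len (N k)))"
proof -
  have "{..<m} \<inter> zero_runs N len \<subseteq> {..<N k div R} \<union> {N k..<N k + min (m - N k) (len (N k))}"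
  proof
    fix i assume "i \<in> {..<m} \<inter> zero_runs N len"
    then obtain j where i: "i < m" "N j \<le> i" "i < N j + len (N j)" by (auto simp: zero_runs_def)
    have "N j < N (Suc k)" using i m by linarith
    then have "j \<le> k" using mono by (simp add: strict_mono_less)
    show "i \<in> {..<N k div R} \<union> {N k..<N k + min (m - N k) (len (N k))}"
    proof (cases "j = k")
      case True
      then show ?thesis using i by auto
    next
      case False
      then have "N (Suc j) \<le> N k" using \<open>j \<le> k\<close> mono by (simp add: strict_mono_less_eq)
      have "Suc i * R \<le> (N j + len (N j)) * R" using i by (intro mult_right_mono) auto
      also have "\<dots> = R * (N j + len (N j))" by simp
      also have "\<dots> \<le> N k" using gap[of j] \<open>N (Suc j) \<le> N k\<close> by linarith
      finally have "Suc i \<le> N k div R" using R by (simp add: less_eq_div_iff_mult_less_eq)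
      then show ?thesis by simp
    qed
  qed
  then have "card ({..<m} \<inter> zero_runs N len)
      \<le> card ({..<N k div R} \<union> {N k..<N k + min (m - N k) (len (N k))})"
    by (intro card_mono) auto
  also have "\<dots> \<le> N k div R + min (m - N k) (len (N k))"
    by (rule order.trans[OF card_Un_le]) simp
  finally have "real (card ({..<m} \<inter> zero_runs N len))
      \<le> real (N k div R) + real (min (m - N k) (len (N k)))" by linarith
  also have "real (N k div R) \<le> real (N k) / real R" by (rule of_nat_div_le_of_nat)
  finally show ?thesis by simp
qed

lemma strict_mono_bracket:
  fixes N :: "nat \<Rightarrow> nat"
  assumes "strict_mono N" "N 0 \<le> m"
  obtains k where "N k \<le> m" "m < N (Suc k)"
proof -
  have "m < N (Suc m)" using strict_mono_imp_increasing[OF assms(1), of "Suc m"] by simp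
  then have ex: "\<exists>k. m < N (Suc k)" by blast
  define k where "k = (LEAST k. m < N (Suc k))"
  have "m < N (Suc k)" unfolding k_def by (rule LeastI_ex[OF ex])
  moreover have "N k \<le> m"
  proof (cases k)
    case (Suc j)
    then have "\<not> m < N (Suc j)" using not_less_Least[of j "\<lambda>k. m < N (Suc k)"] k_def by simp
    then show ?thesis using Suc by simp
  qed (use assms in simp)
  ultimately show ?thesis using that by blast
qed

text \<open>In multiplicative form, \<open>m\<close> is the level with
  \<open>b ^ m \<le> 1 / r < b ^ (m + 1)\<close>, the number of base-\<open>b\<close> digits visible
  at scale \<open>r\<close>.\<close>

lemma exists_scale:
  assumes "1 < b" "0 < r" "r \<le> (1::real)"
  obtains m :: nat where "real m * ln b \<le> - ln r" "- ln r < (real m + 1) * ln b"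
proof -
  define m where "m = nat \<lfloor>- ln r / ln b\<rfloor>"
  have lb: "ln b > 0" using assms by simp
  have "0 \<le> - ln r / ln b" using assms lb by (intro divide_nonneg_pos) auto
  then have "real m \<le> - ln r / ln b" "- ln r / ln b < real m + 1"
    unfolding m_def by (simp_all add: floor_less_iff)
  then have "real m * ln b \<le> - ln r" "- ln r < (real m + 1) * ln b"
    using lb by (simp_all only: pos_le_divide_eq pos_divide_less_eq)
  then show ?thesis by (rule that)
qed

subsection \<open>The dimension\<close>

text \<open>The slack \<open>e\<close> absorbs sets of diameter 0, whose gauge vanishes for \<open>s > 0\<close>.\<close>

lemma exists_cover_radius:
  fixes U :: "'a::metric_space set"
  assumes "0 \<le> s" "0 < e" "U \<noteq> {}" "bounded U" "diameter U \<le> 1"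
  obtains r where "0 < r" "r \<le> 1" "diameter U \<le> r" "ennreal (r powr s) \<le> diam_powr s U + ennreal e"
proof (cases "s = 0 \<or> diameter U > 0")
  case True
  show ?thesis
  proof (cases "s = 0")
    case True
    then show ?thesis using that[of 1] assms by (simp add: diam_powr_def)
  next
    case False
    then show ?thesis using True that[of "diameter U"] assms by (simp add: diam_powr_def)
  qed
next
  case False
  then have s: "s > 0" and U: "diameter U = 0"
    using assms(1) diameter_ge_0[OF assms(4)] by auto
  \<comment> \<open>The largest radius up to 1 whose gauge is at most \<open>e\<close>.\<close>
  define r where "r = min 1 (e powr (1 / s))"
  have "r powr s \<le> (e powr (1 / s)) powr s"
    using s assms(2) by (intro powr_mono2) (auto simp: r_def)
  also have "\<dots> = e" using s assms(2) by (simp add: powr_powr)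
  finally have "ennreal (r powr s) \<le> diam_powr s U + ennreal e"
    by (intro add_increasing ennreal_leI) auto
  then show ?thesis using that[of r] U assms(2) by (simp add: r_def)
qed

text \<open>A cover of small cost would cover the whole probability space of digit pairs by sets of
  total mass below 1. The gap between \<open>s\<close> and \<open>t\<close> pays for the entropy
  lost in earlier runs.\<close>

lemma hausdorff_measure_S_star_ne_0:
  assumes \<tau>: "\<tau> > 0" and s: "0 \<le> s" "s < t" and t: "t \<le> 1" "t * (ln 2 + \<tau>) \<le> ln 2 + ln 3"
  shows "hausdorff_measure s (S_star \<tau>) \<noteq> 0"
proof
  assume H0: "hausdorff_measure s (S_star \<tau>) = 0"
  define l k where "l = ln (2::real)" and "k = ln (3::real)"
  have lk: "l > 0" "k > 0" by (auto simp: l_def k_def)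
  \<comment> \<open>Earlier runs occupy at most \<open>n / R\<close> positions in each base, where
    \<open>n\<close> is the start of the current run. This \<open>R\<close> keeps their loss
    \<open>n * (l + k) / R\<close> below \<open>(t - s) * n * l\<close>, hence below
    \<open>(t - s) * L\<close>.\<close>
  define R where "R = nat \<lceil>(l + k) / ((t - s) * l)\<rceil> + 1"
  have R: "R > 0" by (simp add: R_def)
  have Rle: "(l + k) / real R \<le> (t - s) * l"
  proof -
    have p: "(t - s) * l > 0" using s lk by simp
    have "(l + k) / ((t - s) * l) \<le> real R" unfolding R_def by linarith
    then show ?thesis using p R by (simp add: pos_divide_le_eq mult.commute)
  qed
  \<comment> \<open>Adding 1 to the floor makes both approximation inequalities strict and keeps the
    runs nonempty even for \<open>n = 0\<close>, the first starting position.\<close>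
  define a c where "a n = nat \<lfloor>real n * \<tau> / l\<rfloor> + 1" and "c n = nat \<lfloor>(real n)\<^sup>2 / k\<rfloor> + 1" for n
  have a: "real n * \<tau> < real (a n) * l" "real (a n) * l \<le> real n * \<tau> + l" for n
  proof -
    have "real n * \<tau> / l \<ge> 0" using \<tau> lk by simp
    then have "real n * \<tau> / l < real (a n)" "real (a n) \<le> real n * \<tau> / l + 1"
      unfolding a_def by linarith+
    then show "real n * \<tau> < real (a n) * l" "real (a n) * l \<le> real n * \<tau> + l"
      using lk by (simp_all add: field_simps)
  qed
  have c: "(real n)\<^sup>2 < real (c n) * k" for n
  proof -
    have "(real n)\<^sup>2 / k < real (c n)" unfolding c_def by linarith
    then show ?thesis using lk by (simp add: field_simps)
  qed
  \<comment> \<open>One sequence of starting positions serves both bases; the sum of both lengths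
    yields both gap conditions at once.\<close>
  define N where "N j = ((\<lambda>n. R * (n + a n + c n)) ^^ j) 0" for j
  have N0: "N 0 = 0" and NS: "N (Suc j) = R * (N j + a (N j) + c (N j))" for j
    by (simp_all add: N_def)
  have mono: "strict_mono N"
  proof (rule strict_mono_Suc_iff[THEN iffD2], rule allI)
    fix j
    have "N j < N j + a (N j) + c (N j)" by (simp add: a_def)
    also have "\<dots> \<le> N (Suc j)" using R unfolding NS by simp
    finally show "N j < N (Suc j)" .
  qed
  have gap: "R * (N j + a (N j)) \<le> N (Suc j)" "R * (N j + c (N j)) \<le> N (Suc j)" for j
    unfolding NS by simp_all
  define Z1 Z2 where "Z1 = zero_runs N a" and "Z2 = zero_runs N c"
  have Zinf: "infinite Z1" "infinite Z2"
    unfolding Z1_def Z2_def using infinite_zero_runs[OF mono] by (auto simp: a_def c_def)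
  define X Y where "X d = digit_sum 2 (erase Z1 d)" and "Y d = digit_sum 3 (erase Z2 d)" for d
  let ?M2 = "digit_measure 2" and ?M3 = "digit_measure 3"
  let ?M = "?M2 \<Otimes>\<^sub>M ?M3"
  interpret M2: prob_space ?M2 by (rule prob_space_digit_measure) simp
  interpret M3: prob_space ?M3 by (rule prob_space_digit_measure) simp

  \<comment> \<open>Membership of the random points in the limsup set\<close>
  have in_S_star: "(X d1, Y d2) \<in> S_star \<tau>" if d1: "d1 \<in> space ?M2" and d2: "d2 \<in> space ?M3" for d1 d2
  proof -
    have lt: "erase Z1 d1 i < 2" "erase Z2 d2 i < 3" for i
      using erase_less[OF _ d1] erase_less[OF _ d2] by auto
    have "dist_nearest_int (2 ^ n * X d1) < exp (- (real n * \<tau>))" if n: "n = N j" for n j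
    proof -
      have "dist_nearest_int (2 ^ n * X d1) \<le> 1 / 2 ^ a n"
        using dist_nearest_int_digit_sum_le[of 2 "erase Z1 d1" n "a n"] lt n
        by (force simp: X_def erase_def Z1_def zero_runs_def)
      also have "\<dots> = exp (- (real (a n) * l))"
        by (simp add: exp_minus exp_of_nat_mult l_def inverse_eq_divide)
      also have "\<dots> < exp (- (real n * \<tau>))" using a by simp
      finally show ?thesis .
    qed
    moreover have "dist_nearest_int (3 ^ n * Y d2) < exp (- ((real n)\<^sup>2))" if n: "n = N j" for n j
    proof -
      have "dist_nearest_int (3 ^ n * Y d2) \<le> 1 / 3 ^ c n"
        using dist_nearest_int_digit_sum_le[of 3 "erase Z2 d2" n "c n"] lt n
        by (force simp: Y_def erase_def Z2_def zero_runs_def)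
      also have "\<dots> = exp (- (real (c n) * k))"
        by (simp add: exp_minus exp_of_nat_mult k_def inverse_eq_divide)
      also have "\<dots> < exp (- ((real n)\<^sup>2))" using c by simp
      finally show ?thesis .
    qed
    ultimately have sub: "range N \<subseteq> {n. dist_nearest_int (2 ^ n * X d1) < exp (- (real n * \<tau>)) \<and>
                          dist_nearest_int (3 ^ n * Y d2) < exp (- ((real n)\<^sup>2))}" by blast
    have "infinite (range N)"
      using mono by (simp add: range_inj_infinite strict_mono_imp_inj_on)
    then have "infinite {n. dist_nearest_int (2 ^ n * X d1) < exp (- (real n * \<tau>)) \<and>
                          dist_nearest_int (3 ^ n * Y d2) < exp (- ((real n)\<^sup>2))}"
      using sub infinite_super by blast
    then show ?thesis
      unfolding S_star_def X_def Y_def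
      using lt digit_sum_nonneg[of 2 "erase Z1 d1"] digit_sum_le_1[of 2 "erase Z1 d1"]
        digit_sum_nonneg[of 3 "erase Z2 d2"] digit_sum_le_1[of 3 "erase Z2 d2"] by auto
  qed

  \<comment> \<open>Probability of hitting a set of diameter at most \<open>r\<close>\<close>
  have small: "\<exists>C\<in>sets ?M. emeasure ?M C \<le> ennreal (48 * r powr s) \<and>
      (\<forall>d1\<in>space ?M2. \<forall>d2\<in>space ?M3. (X d1, Y d2) \<in> U \<longrightarrow> (d1, d2) \<in> C)"
    if U: "bounded U" "diameter U \<le> r" and r: "0 < r" "r \<le> 1" for U :: "(real \<times> real) set" and r
  proof -
    define L where "L = - ln r"
    obtain m where m: "real m * l \<le> L" "L < (real m + 1) * l"
      using exists_scale[of 2 r] r unfolding L_def l_def by auto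
    obtain m' where m': "real m' * k \<le> L" "L < (real m' + 1) * k"
      using exists_scale[of 3 r] r unfolding L_def k_def by auto
    have rm: "r \<le> 1 / 2 ^ m" "r \<le> 1 / 3 ^ m'"
    proof -
      have "r = exp (- L)" using r by (simp add: L_def)
      moreover have "exp (- L) \<le> exp (- (real m * l))" "exp (- L) \<le> exp (- (real m' * k))"
        using m m' by simp_all
      ultimately show "r \<le> 1 / 2 ^ m" "r \<le> 1 / 3 ^ m'"
        by (simp_all add: exp_minus exp_of_nat_mult l_def k_def inverse_eq_divide)
    qed
    have dU: "dist x y \<le> r" if "x \<in> U" "y \<in> U" for x y
      using diameter_bounded_bound[OF U(1) that] U(2) by linarith
    have V1: "\<bar>x - y\<bar> \<le> 1 / real 2 ^ m" if xy: "x \<in> fst ` U" "y \<in> fst ` U" for x y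
    proof -
      obtain p q where "p \<in> U" "q \<in> U" "x = fst p" "y = fst q" using xy by blast
      then show ?thesis using dU[of p q] dist_fst_le[of p q] rm by (simp add: dist_real_def)
    qed
    have V2: "\<bar>x - y\<bar> \<le> 1 / real 3 ^ m'" if xy: "x \<in> snd ` U" "y \<in> snd ` U" for x y
    proof -
      obtain p q where "p \<in> U" "q \<in> U" "x = snd p" "y = snd q" using xy by blast
      then show ?thesis using dU[of p q] dist_snd_le[of p q] rm by (simp add: dist_real_def)
    qed
    obtain C1 where C1: "C1 \<in> sets ?M2"
      "emeasure ?M2 C1 \<le> ennreal (2 * (1 / real 2) ^ card ({..<m} - Z1))"
      "\<And>d. d \<in> space ?M2 \<Longrightarrow> X d \<in> fst ` U \<Longrightarrow> d \<in> C1"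
      using digit_measure_small_set[of 2 Z1 "fst ` U" m] Zinf V1 unfolding X_def by auto
    obtain C2 where C2: "C2 \<in> sets ?M3"
      "emeasure ?M3 C2 \<le> ennreal (2 * (1 / real 3) ^ card ({..<m'} - Z2))"
      "\<And>d. d \<in> space ?M3 \<Longrightarrow> Y d \<in> snd ` U \<Longrightarrow> d \<in> C2"
      using digit_measure_small_set[of 3 Z2 "snd ` U" m'] Zinf V2 unfolding Y_def by auto
    define G1 G2 where "G1 = real (card ({..<m} \<inter> Z1))" and "G2 = real (card ({..<m'} \<inter> Z2))"
    have f: "real (card ({..<m} - Z1)) = real m - G1" "real (card ({..<m'} - Z2)) = real m' - G2"
      using card_Int_Diff[of "{..<m}" Z1] card_Int_Diff[of "{..<m'}" Z2]
      by (simp_all add: G1_def G2_def)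
    obtain j where j: "N j \<le> m" "m < N (Suc j)"
      using strict_mono_bracket[OF mono, of m] N0 by auto
    \<comment> \<open>Fewer ternary than binary digits are visible at a given scale, so
      \<open>m' \<le> m < N (Suc j)\<close> and the same \<open>j\<close> serves for both
      bases.\<close>
    have "l < k" by (simp add: l_def k_def)
    have "m' \<le> m"
    proof -
      have "real m' * l \<le> real m' * k" using \<open>l < k\<close> by (intro mult_left_mono) auto
      then have "real m' * l < (real m + 1) * l" using m m' by linarith
      then show ?thesis using lk by simp
    qed
    define n where "n = real (N j)"
    have nm: "0 \<le> n" "n \<le> real m" using j by (simp_all add: n_def)
    have G1: "G1 \<le> n / real R + min (real m - n) (real (a (N j)))"
      using card_zero_runs_le[OF R mono gap(1) j(2)] j(1) by (simp add: G1_def Z1_def n_def of_nat_diff)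
    \<comment> \<open>All ternary digits from position \<open>n\<close> on are counted as lost, and
      \<open>max 0\<close> covers the case that the run starts beyond \<open>m'\<close>.\<close>
    have G2: "G2 \<le> n / real R + max 0 (real m' - n)"
    proof -
      have "G2 \<le> n / real R + real (min (m' - N j) (c (N j)))"
        using card_zero_runs_le[OF R mono gap(2), of m' j] j \<open>m' \<le> m\<close>
        by (simp add: G2_def Z2_def n_def)
      moreover have "real (min (m' - N j) (c (N j))) \<le> max 0 (real m' - n)"
        by (simp add: n_def)
      ultimately show ?thesis by linarith
    qed
    have "min (real m - n) (real (a (N j))) * l \<le> min ((real m - n) * l) (n * \<tau>) + l"
      using a(2)[of "N j"] lk by (simp add: min_mult_distrib_right n_def)
    moreover have "max 0 (real m' - n) * k = max 0 ((real m' - n) * k)"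
      using lk by (auto simp: max_def mult_le_0_iff zero_le_mult_iff)
    moreover have "min ((real m - n) * l) (n * \<tau>) + max 0 ((real m' - n) * k) \<le> (2 - t) * L"
      using zero_run_tradeoff[of l k \<tau> t n "real m" L "real m'"] lk \<tau> s t nm m m'
      by (simp add: l_def k_def)
    moreover have "G1 * l + G2 * k \<le> (n / real R + min (real m - n) (real (a (N j)))) * l
        + (n / real R + max 0 (real m' - n)) * k"
      using G1 G2 lk by (intro add_mono mult_right_mono) auto
    moreover have "n / real R * l + n / real R * k \<le> (t - s) * L"
    proof -
      have "n * l \<le> real m * l" using nm lk by (intro mult_right_mono) auto
      then have "n * l \<le> L" using m by linarith
      have "n / real R * l + n / real R * k = n * ((l + k) / real R)"
        by (simp add: add_divide_distrib distrib_left)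
      also have "\<dots> \<le> n * ((t - s) * l)" using Rle nm by (intro mult_left_mono) auto
      also have "\<dots> = (t - s) * (n * l)" by simp
      also have "\<dots> \<le> (t - s) * L" using \<open>n * l \<le> L\<close> s by (intro mult_left_mono) auto
      finally show ?thesis .
    qed
    ultimately have G: "G1 * l + G2 * k \<le> (2 - s) * L + l" by (simp add: algebra_simps)
    have "(1 / real 2) ^ card ({..<m} - Z1) * (1 / real 3) ^ card ({..<m'} - Z2)
        = exp (- ((real m - G1) * l)) * exp (- ((real m' - G2) * k))"
      unfolding f[symmetric]
      by (simp add: exp_minus exp_of_nat_mult l_def k_def power_one_over inverse_eq_divide)
    also have "\<dots> = exp (- ((real m - G1) * l) - (real m' - G2) * k)" by (simp add: mult_exp_exp)
    \<comment> \<open>Rounding down \<open>m\<close> and \<open>m'\<close> costs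
      \<open>l + k\<close>, and rounding up the binary run length costs another \<open>l\<close>.
      Together they give the factor 12, and two cylinders in each base raise it to 48.\<close>
    also have "\<dots> \<le> exp (2 * l + k - s * L)"
      using G m m' by (simp add: algebra_simps)
    also have "\<dots> = 12 * r powr s"
      using r by (simp add: exp_add exp_diff exp_double l_def k_def L_def powr_def exp_minus field_simps)
    finally have w: "(2 * (1 / real 2) ^ card ({..<m} - Z1)) * (2 * (1 / real 3) ^ card ({..<m'} - Z2))
        \<le> 48 * r powr s" by simp
    have "emeasure ?M (C1 \<times> C2) = emeasure ?M2 C1 * emeasure ?M3 C2"
      using C1 C2 by (intro M3.emeasure_pair_measure_Times)
    also have "\<dots> \<le> ennreal (2 * (1 / real 2) ^ card ({..<m} - Z1)) * ennreal (2 * (1 / real 3) ^ card ({..<m'} - Z2))"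
      using C1 C2 by (intro mult_mono) auto
    also have "\<dots> \<le> ennreal (48 * r powr s)"
      using w by (simp only: ennreal_mult[symmetric] ennreal_leI zero_le_mult_iff zero_le_power
          zero_le_divide_iff of_nat_0_le_iff zero_le_numeral zero_le_one simp_thms)
    finally have "emeasure ?M (C1 \<times> C2) \<le> ennreal (48 * r powr s)" .
    moreover have "C1 \<times> C2 \<in> sets ?M" using C1 C2 by simp
    moreover have "(d1, d2) \<in> C1 \<times> C2"
      if "d1 \<in> space ?M2" "d2 \<in> space ?M3" "(X d1, Y d2) \<in> U" for d1 d2
      using C1(3)[OF that(1)] C2(3)[OF that(2)] that(3) by force
    ultimately show ?thesis by blast
  qed

  \<comment> \<open>Mass distribution against a cheap cover\<close>
  obtain U :: "nat \<Rightarrow> (real \<times> real) set" where U: "S_star \<tau> \<subseteq> (\<Union>i. U i)" "\<And>i. bounded (U i)"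
    "\<And>i. diameter (U i) \<le> 1" "(\<Sum>i. diam_powr s (U i)) < ennreal (1 / 192)"
    using hausdorff_measure_zero_cover[OF H0, of 1 "ennreal (1 / 192)"] by auto
  \<comment> \<open>The slacks sum to 1/192, as does the allowance for the cover, so the total mass
    is at most \<open>48 * 2 / 192 = 1 / 2\<close>.\<close>
  define e where "e i = (1 / 2) ^ Suc i / (192::real)" for i :: nat
  have e: "e i > 0" for i by (simp add: e_def)
  have "\<exists>C\<in>sets ?M. emeasure ?M C \<le> 48 * (diam_powr s (U i) + ennreal (e i)) \<and>
      (\<forall>d1\<in>space ?M2. \<forall>d2\<in>space ?M3. (X d1, Y d2) \<in> U i \<longrightarrow> (d1, d2) \<in> C)" for i
  proof (cases "U i = {}")
    case False
    obtain r where r: "0 < r" "r \<le> 1" "diameter (U i) \<le> r"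
      "ennreal (r powr s) \<le> diam_powr s (U i) + ennreal (e i)"
      using exists_cover_radius[OF s(1) e False U(2) U(3)] .
    have "ennreal (48 * r powr s) = 48 * ennreal (r powr s)" by (simp add: ennreal_mult)
    also have "\<dots> \<le> 48 * (diam_powr s (U i) + ennreal (e i))" using r(4) by (intro mult_left_mono) auto
    finally show ?thesis using small[OF U(2) r(3,1,2)] by (meson order.trans)
  qed (intro bexI[of _ "{}"], auto)
  then obtain C where C: "\<And>i. C i \<in> sets ?M"
    "\<And>i. emeasure ?M (C i) \<le> 48 * (diam_powr s (U i) + ennreal (e i))"
    "\<And>i d1 d2. d1 \<in> space ?M2 \<Longrightarrow> d2 \<in> space ?M3 \<Longrightarrow> (X d1, Y d2) \<in> U i \<Longrightarrow> (d1, d2) \<in> C i"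
    by metis
  have "space ?M2 \<times> space ?M3 \<subseteq> (\<Union>i. C i)"
    using in_S_star U(1) C(3) by fastforce
  then have "emeasure ?M (space ?M2 \<times> space ?M3) \<le> emeasure ?M (\<Union>i. C i)"
    using C(1) by (intro emeasure_mono) auto
  moreover have "emeasure ?M (space ?M2 \<times> space ?M3) = 1"
    by (subst M3.emeasure_pair_measure_Times) (auto simp: M2.emeasure_space_1 M3.emeasure_space_1)
  ultimately have "1 \<le> emeasure ?M (\<Union>i. C i)" by simp
  also have "\<dots> \<le> (\<Sum>i. emeasure ?M (C i))"
    using C(1) by (intro emeasure_subadditive_countably) auto
  also have "\<dots> \<le> (\<Sum>i. 48 * (diam_powr s (U i) + ennreal (e i)))"
    by (intro suminf_le C(2) summableI)
  also have "\<dots> = 48 * ((\<Sum>i. diam_powr s (U i)) + (\<Sum>i. ennreal (e i)))"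
    by (simp add: ennreal_suminf_cmult suminf_add[symmetric])
  also have "(\<Sum>i. ennreal (e i)) = ennreal (1 / 192)"
  proof (rule suminf_ennreal_eq)
    show "e sums (1 / 192)"
      unfolding e_def using sums_divide[OF power_half_series, of 192] by simp
  qed (use e in \<open>simp add: less_imp_le\<close>)
  also have "48 * ((\<Sum>i. diam_powr s (U i)) + ennreal (1 / 192)) \<le> 48 * (ennreal (1 / 192) + ennreal (1 / 192))"
    using U(4) by (intro mult_left_mono add_right_mono) auto
  also have "\<dots> = ennreal (48 * (1 / 192 + 1 / 192))"
    by (simp only: ennreal_plus ennreal_mult) simp
  also have "\<dots> < ennreal 1" by (rule ennreal_lessI) simp_all
  finally show False by simp
qed

theorem theorem2:
  fixes \<tau> :: real
  assumes "\<tau> > 0"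
  shows "hausdorff_dim (S_star \<tau>) = ennreal (min 1 ((ln 2 + ln 3) / (ln 2 + \<tau>)))"
proof (rule antisym)
  have pos: "ln 2 + \<tau> > 0" using assms by (intro add_pos_pos) auto
  have "0 \<le> (ln 2 + ln 3) / (ln 2 + \<tau>)"
    by (intro divide_nonneg_pos[OF _ pos] add_nonneg_nonneg) auto
  then show "hausdorff_dim (S_star \<tau>) \<le> ennreal (min 1 ((ln 2 + ln 3) / (ln 2 + \<tau>)))"
    using hausdorff_measure_S_star_eq_0_of_gt_ratio[OF assms]
      hausdorff_measure_S_star_eq_0_of_gt_1[OF assms]
    by (intro hausdorff_dim_le) (auto simp: min_less_iff_disj)
  \<comment> \<open>The claimed dimension itself is taken as \<open>t\<close>; this verifies its
    second constraint.\<close>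
  have "min 1 ((ln 2 + ln 3) / (ln 2 + \<tau>)) * (ln 2 + \<tau>)
      \<le> (ln 2 + ln 3) / (ln 2 + \<tau>) * (ln 2 + \<tau>)"
    using pos by (intro mult_right_mono) auto
  also have "\<dots> = ln 2 + ln 3" using pos by simp
  finally show "ennreal (min 1 ((ln 2 + ln 3) / (ln 2 + \<tau>))) \<le> hausdorff_dim (S_star \<tau>)"
    using hausdorff_measure_S_star_ne_0[OF assms] by (intro hausdorff_dim_ge) (meson min.cobounded1)
qed

end
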